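(* Let $A$ be a Banach algebra and let $B$ be a Banach $A$-bimodule. Then for every even number $n\geq 2$ the following assertions hold. (1) $Z^{\ell}_{A^{(n)}}(B^{(n+1)})=B^{(n+1)}$ if and only if $\tilde{Z}^{r}_{A^{(n)}}(B^{(n)})=B^{(n)}$. (2) $Z^{\ell}_{A^{(n)}}(A^{(n+1)})=A^{(n+1)}$ if and only if $\tilde{Z}^{r}_1(A^{(n)})=A^{(n)}$. (3) $Z^{r}_{A^{(n)}}(A^{(n+1)})=A^{(n+1)}$ if and only if $\tilde{Z}^{\ell}_1(A^{(n)})=A^{(n)}$. (4) $Z^{r}_{A^{(n)}}(B^{(n+1)})=B^{(n+1)}$ if and only if $\tilde{Z}^{\ell}_{A^{(n)}}(B^{(n)})=B^{(n)}$.
   Context: $X^{(n)}$ is the $n$-th dual of a Banach space $X$ ($X^{(0)}=X$), and the weak* topology of $X^{(n)}$ ($n\ge1$) is $\sigma(X^{(n)},X^{(n-1)})$. For a Banach algebra $A$, $A^{**}$ carries the first Arens product $a''c''=w^*\text{-}\lim_\alpha w^*\text{-}\lim_\beta a_\alpha c_\beta$, where $(a_\alpha),(c_\beta)\subseteq A$ converge weak* to $a'',c''$. For a Banach $A$-bimodule $B$, $B^{**}$ is a Banach $A^{**}$-bimodule via $a''b''=w^*\text{-}\lim_\alpha w^*\text{-}\lim_\beta a_\alpha b_\beta$ and $b''a''=w^*\text{-}\lim_\beta w^*\text{-}\lim_\alpha b_\beta a_\alpha$, where $(a_\alpha)\subseteq A,(b_\beta)\subseteq B$ converge weak* to $a'',b''$.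 Iterating, for even $n$, $A^{(n)}=(A^{(n-2)})^{**}$ is a Banach algebra and $B^{(n)}=(B^{(n-2)})^{**}$ is a Banach $A^{(n)}$-bimodule. The dual $B^{(n+1)}$ of $B^{(n)}$ is the dual $A^{(n)}$-bimodule: $\langle \varphi a,b\rangle=\langle\varphi,ab\rangle$, $\langle a\varphi,b\rangle=\langle\varphi,ba\rangle$ for $\varphi\in B^{(n+1)}$, $a\in A^{(n)}$, $b\in B^{(n)}$. For even $n\ge2$: $Z^{\ell}_{A^{(n)}}(B^{(n+1)})$ (resp. $Z^{r}_{A^{(n)}}(B^{(n+1)})$) is the set of $\varphi\in B^{(n+1)}$ for which $a\mapsto\varphi a$ (resp. $a\mapsto a\varphi$), $A^{(n)}\to B^{(n+1)}$, is weak*-to-weak* continuous; $\tilde{Z}^{\ell}_{A^{(n)}}(B^{(n)})$ (resp. $\tilde{Z}^{r}_{A^{(n)}}(B^{(n)})$) is the set of $b\in B^{(n)}$ for which $a\mapsto ba$ (resp. $a\mapsto ab$), $A^{(n)}\to B^{(n)}$, is weak*-to-weak continuous. For $B=A$ write $\tilde{Z}^{\ell}_1(A^{(n)})=\tilde{Z}^{\ell}_{A^{(n)}}(A^{(n)})$ and $\tilde{Z}^{r}_1(A^{(n)})=\tilde{Z}^{r}_{A^{(n)}}(A^{(n)})$. *)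

theory Defs
  imports "HOL-Analysis.Analysis" "HOL-Algebra.Module"
begin

section \<open>Banach spaces, Banach algebras and Banach bimodules\<close>

text \<open>
  Since the order \<open>n\<close> of a dual is a variable, spaces are carrier sets inside a type, not types. The scalars form an arbitrary \<open>real_normed_field\<close>;
  up to isometric isomorphism these are exactly the real and the complex numbers.
\<close>

record ('k, 'u) nspace = "('k, 'u) module" +
  nrm :: "'u \<Rightarrow> real"

definition scalars :: "'k::field ring" where
  "scalars = \<lparr>carrier = UNIV, mult = (*), one = 1, zero = 0, add = (+)\<rparr>"

locale banach_space = module scalars X for X :: "('k::real_normed_field, 'u) nspace" (structure) +
  assumes nrm_eq_0_iff: "x \<in> carrier X \<Longrightarrow> nrm X x = 0 \<longleftrightarrow> x = \<zero>"
    and nrm_add_le: "\<lbrakk>x \<in> carrier X; y \<in> carrier X\<rbrakk> \<Longrightarrow> nrm X (x \<oplus> y) \<le> nrm X x + nrm X y"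
    and nrm_smult: "x \<in> carrier X \<Longrightarrow> nrm X (c \<odot> x) = norm c * nrm X x"
    and complete: "Metric_space.mcomplete (carrier X) (\<lambda>x y. nrm X (x \<ominus> y))"

definition linear_map :: "('k::field, 'u) nspace \<Rightarrow> ('k, 'v) nspace \<Rightarrow> ('u \<Rightarrow> 'v) \<Rightarrow> bool" where
  "linear_map X Y f \<longleftrightarrow> f \<in> carrier X \<rightarrow> carrier Y \<and>
     (\<forall>x\<in>carrier X. \<forall>y\<in>carrier X. f (x \<oplus>\<^bsub>X\<^esub> y) = f x \<oplus>\<^bsub>Y\<^esub> f y) \<and>
     (\<forall>c. \<forall>x\<in>carrier X. f (c \<odot>\<^bsub>X\<^esub> x) = c \<odot>\<^bsub>Y\<^esub> f x)"

definition bounded_bilinear_map ::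
  "('k::field, 'u) nspace \<Rightarrow> ('k, 'v) nspace \<Rightarrow> ('k, 'w) nspace \<Rightarrow> ('u \<Rightarrow> 'v \<Rightarrow> 'w) \<Rightarrow> bool" where
  "bounded_bilinear_map X Y Z m \<longleftrightarrow>
     (\<forall>x\<in>carrier X. linear_map Y Z (m x)) \<and>
     (\<forall>y\<in>carrier Y. linear_map X Z (\<lambda>x. m x y)) \<and>
     (\<exists>K. \<forall>x\<in>carrier X. \<forall>y\<in>carrier Y. nrm Z (m x y) \<le> K * nrm X x * nrm Y y)"

text \<open>The product of a Banach algebra is the field \<open>mult\<close>. There need not be a unit: the field
  \<open>one\<close> is never used.\<close>

locale banach_algebra = banach_space A for A :: "('k::real_normed_field, 'u) nspace" (structure) +
  assumes mult_bilinear: "bounded_bilinear_map A A A (mult A)"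
    and mult_assoc: "\<lbrakk>a \<in> carrier A; b \<in> carrier A; c \<in> carrier A\<rbrakk> \<Longrightarrow> (a \<otimes> b) \<otimes> c = a \<otimes> (b \<otimes> c)"
    and nrm_mult_le: "\<lbrakk>a \<in> carrier A; b \<in> carrier A\<rbrakk> \<Longrightarrow> nrm A (a \<otimes> b) \<le> nrm A a * nrm A b"

locale banach_bimodule = A: banach_algebra A + B: banach_space B
  for A :: "('k::real_normed_field, 'u) nspace" and B :: "('k, 'v) nspace"
    and lact :: "'u \<Rightarrow> 'v \<Rightarrow> 'v" and ract :: "'v \<Rightarrow> 'u \<Rightarrow> 'v" +
  assumes lact_bilinear: "bounded_bilinear_map A B B lact"
    and ract_bilinear: "bounded_bilinear_map B A B ract"
    and lact_lact: "\<lbrakk>a \<in> carrier A; a' \<in> carrier A; b \<in> carrier B\<rbrakk> \<Longrightarrow>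
      lact (a \<otimes>\<^bsub>A\<^esub> a') b = lact a (lact a' b)"
    and ract_ract: "\<lbrakk>a \<in> carrier A; a' \<in> carrier A; b \<in> carrier B\<rbrakk> \<Longrightarrow>
      ract b (a \<otimes>\<^bsub>A\<^esub> a') = ract (ract b a) a'"
    and lact_ract: "\<lbrakk>a \<in> carrier A; a' \<in> carrier A; b \<in> carrier B\<rbrakk> \<Longrightarrow>
      ract (lact a b) a' = lact a (ract b a')"


section \<open>Iterated duals\<close>

definition functionals :: "('k::real_normed_field, 'u) nspace \<Rightarrow> ('u \<Rightarrow> 'k) set" where
  "functionals X = {f \<in> extensional (carrier X).
     (\<forall>x\<in>carrier X. \<forall>y\<in>carrier X. f (x \<oplus>\<^bsub>X\<^esub> y) = f x + f y) \<and>
     (\<forall>c. \<forall>x\<in>carrier X. f (c \<odot>\<^bsub>X\<^esub> x) = c * f x) \<and>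
     (\<exists>K. \<forall>x\<in>carrier X. norm (f x) \<le> K * nrm X x)}"

text \<open>
  No type contains literally all of \<open>X\<close>, \<open>X\<^sup>*\<close>, \<open>X\<^sup>*\<^sup>*\<close>, and so on for a varying number of stars. The
  dual of \<open>X\<close> is therefore carried back into the type of \<open>X\<close> along an injective encoding of the
  bounded functionals, which exists as soon as that type is large enough
  (\<open>admits_duals\<close> below); no property of the encoding other than injectivity is available.
\<close>

definition encode :: "('k::real_normed_field, 'u) nspace \<Rightarrow> ('u \<Rightarrow> 'k) \<Rightarrow> 'u" where
  "encode X = (SOME c. inj_on c (functionals X))"

definition pairing :: "('k::real_normed_field, 'u) nspace \<Rightarrow> 'u \<Rightarrow> 'u \<Rightarrow> 'k" where
  "pairing X \<phi> = inv_into (functionals X) (encode X) \<phi>"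

definition functional :: "('k::real_normed_field, 'u) nspace \<Rightarrow> ('u \<Rightarrow> 'k) \<Rightarrow> 'u" where
  "functional X f = encode X (restrict f (carrier X))"

definition dual :: "('k::real_normed_field, 'u) nspace \<Rightarrow> ('k, 'u) nspace" where
  "dual X = \<lparr>carrier = encode X ` functionals X,
     mult = undefined, one = undefined,
     zero = functional X (\<lambda>x. 0),
     add = (\<lambda>\<phi> \<psi>. functional X (\<lambda>x. pairing X \<phi> x + pairing X \<psi> x)),
     smult = (\<lambda>c \<phi>. functional X (\<lambda>x. c * pairing X \<phi> x)),
     nrm = (\<lambda>\<phi>. SUP x\<in>{x \<in> carrier X. nrm X x \<le> 1}. norm (pairing X \<phi> x))\<rparr>"

abbreviation ndual :: "nat \<Rightarrow> ('k::real_normed_field, 'u) nspace \<Rightarrow> ('k, 'u) nspace" where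
  "ndual n X \<equiv> (dual ^^ n) X"

text \<open>The type of \<open>X\<close> has room for the duals of \<open>X\<close> up to order \<open>n\<close>. This is only a condition on
  the cardinality of the type: \<open>X\<close> can be copied into a larger type, and
  \<open>admits_dualsI\<close> shows that finitely many iterated function spaces suffice.\<close>

definition admits_duals :: "nat \<Rightarrow> ('k::real_normed_field, 'u) nspace \<Rightarrow> bool" where
  "admits_duals n X \<longleftrightarrow> (\<forall>i<n. functionals (ndual i X) \<lesssim> (UNIV :: 'u set))"

lemma admits_dualsI:
  fixes X :: "('k::real_normed_field, 'u) nspace" and S :: "nat \<Rightarrow> 'u set"
  assumes X: "carrier X \<lesssim> S 0"
    and S: "\<And>i. i < n \<Longrightarrow> (S i \<rightarrow>\<^sub>E (UNIV :: 'k set)) \<lesssim> S (Suc i)"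
  shows "admits_duals n X"
proof -
  have funs: "functionals Y \<lesssim> S (Suc i)" if "carrier Y \<lesssim> S i" "i < n"
    for i and Y :: "('k, 'u) nspace"
  proof -
    have "functionals Y \<lesssim> (carrier Y \<rightarrow>\<^sub>E (UNIV :: 'k set))"
      by (intro subset_imp_lepoll) (auto simp: functionals_def PiE_def)
    also have "\<dots> \<lesssim> (S i \<rightarrow>\<^sub>E (UNIV :: 'k set))"
      using that(1) by (rule lepoll_funcset_left[rotated]) auto
    also have "\<dots> \<lesssim> S (Suc i)"
      using S that(2) .
    finally show ?thesis .
  qed
  have "carrier (ndual i X) \<lesssim> S i" if "i \<le> n" for i
    using that
  proof (induction i)
    case (Suc i)
    have "carrier (ndual (Suc i) X) \<lesssim> functionals (ndual i X)"
      by (simp add: dual_def image_lepoll)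
    also have "\<dots> \<lesssim> S (Suc i)"
      using Suc by (intro funs) auto
    finally show ?case .
  qed (use X in auto)
  then show ?thesis
    unfolding admits_duals_def
    by (meson funs less_imp_le lepoll_trans subset_UNIV subset_imp_lepoll)
qed

definition canonical :: "('k::real_normed_field, 'u) nspace \<Rightarrow> 'u \<Rightarrow> 'u" where
  "canonical X x = functional (dual X) (\<lambda>\<phi>. pairing X \<phi> x)"


section \<open>Weak topologies\<close>

definition weak_topology :: "('k::real_normed_field, 'u) nspace \<Rightarrow> 'u topology" where
  "weak_topology X = topology_generated_by
     {{x \<in> carrier X. pairing X \<phi> x \<in> U} | \<phi> U. \<phi> \<in> carrier (dual X) \<and> open U}"

text \<open>The topology \<open>\<sigma>(X\<^sup>*, X)\<close>; its underlying set is the carrier of \<open>dual X\<close>.\<close>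

definition weak_star :: "('k::real_normed_field, 'u) nspace \<Rightarrow> 'u topology" where
  "weak_star X = topology_generated_by
     {{\<phi> \<in> carrier (dual X). pairing X \<phi> x \<in> U} | x U. x \<in> carrier X \<and> open U}"


section \<open>Arens extensions\<close>

text \<open>
  Convergence along a net in \<open>X\<close> depends only on the image filter of the net, so nets in \<open>X\<close> are
  proper filters \<open>F\<close> that contain the carrier of \<open>X\<close>. Below \<open>z\<close> is the iterated limit
  \<open>lim\<^sub>\<alpha> lim\<^sub>\<beta> m x\<^sub>\<alpha> y\<^sub>\<beta>\<close>, and \<open>l u\<close> is the inner limit \<open>lim\<^sub>\<beta> m u y\<^sub>\<beta>\<close>. For a bounded bilinear
  \<open>m\<close> on Banach spaces the limit exists for all such nets, and it is unique because \<open>X\<close> is weak*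
  dense in \<open>X\<^sup>*\<^sup>*\<close>, so that nets with the prescribed limits exist.
\<close>

definition net_to :: "('k::real_normed_field, 'u) nspace \<Rightarrow> 'u \<Rightarrow> 'u filter \<Rightarrow> bool" where
  "net_to X x F \<longleftrightarrow> F \<noteq> bot \<and> (\<forall>\<^sub>F u in F. u \<in> carrier X) \<and>
     limitin (weak_star (dual X)) (canonical X) x F"

definition arens ::
  "('k::real_normed_field, 'u) nspace \<Rightarrow> ('k, 'v) nspace \<Rightarrow> ('k, 'w) nspace \<Rightarrow>
   ('u \<Rightarrow> 'v \<Rightarrow> 'w) \<Rightarrow> 'u \<Rightarrow> 'v \<Rightarrow> 'w" where
  "arens X Y Z m x y = (THE z. z \<in> carrier (dual (dual Z)) \<and>
     (\<forall>F G. net_to X x F \<and> net_to Y y G \<longrightarrow>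
       (\<exists>l. (\<forall>u\<in>carrier X. limitin (weak_star (dual Z)) (\<lambda>v. canonical Z (m u v)) (l u) G) \<and>
            limitin (weak_star (dual Z)) l z F)))"

text \<open>\<open>arens_iter X Y Z m j\<close> maps the \<open>2j\<close>-th duals of \<open>X\<close> and \<open>Y\<close> to that of \<open>Z\<close>.\<close>

primrec arens_iter ::
  "('k::real_normed_field, 'u) nspace \<Rightarrow> ('k, 'v) nspace \<Rightarrow> ('k, 'w) nspace \<Rightarrow>
   ('u \<Rightarrow> 'v \<Rightarrow> 'w) \<Rightarrow> nat \<Rightarrow> 'u \<Rightarrow> 'v \<Rightarrow> 'w" where
  "arens_iter X Y Z m 0 = m"
| "arens_iter X Y Z m (Suc j) =
     arens (ndual (2 * j) X) (ndual (2 * j) Y) (ndual (2 * j) Z) (arens_iter X Y Z m j)"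

text \<open>
  For even \<open>n\<close>, these are the actions of \<open>A\<^bsup>(n)\<^esup>\<close> on \<open>B\<^bsup>(n)\<^esup>\<close>. In the right action the
  outer limit is the one over the net in \<open>B\<close>. For \<open>B = A\<close> and both actions equal to the product
  of \<open>A\<close>, both are the (first Arens) product of \<open>A\<^bsup>(n)\<^esup>\<close>.
\<close>

definition nlact :: "nat \<Rightarrow> ('k::real_normed_field, 'u) nspace \<Rightarrow> ('k, 'v) nspace \<Rightarrow>
    ('u \<Rightarrow> 'v \<Rightarrow> 'v) \<Rightarrow> 'u \<Rightarrow> 'v \<Rightarrow> 'v" where
  "nlact n A B lact = arens_iter A B B lact (n div 2)"

definition nract :: "nat \<Rightarrow> ('k::real_normed_field, 'u) nspace \<Rightarrow> ('k, 'v) nspace \<Rightarrow>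
    ('v \<Rightarrow> 'u \<Rightarrow> 'v) \<Rightarrow> 'v \<Rightarrow> 'u \<Rightarrow> 'v" where
  "nract n A B ract = arens_iter B A B ract (n div 2)"

text \<open>The dual actions on \<open>B\<^sup>*\<close>: the left action on \<open>B\<close> induces the right action on \<open>B\<^sup>*\<close> and
  conversely.\<close>

definition dual_ract :: "('k::real_normed_field, 'v) nspace \<Rightarrow> ('u \<Rightarrow> 'v \<Rightarrow> 'v) \<Rightarrow> 'v \<Rightarrow> 'u \<Rightarrow> 'v" where
  "dual_ract B lact \<phi> a = functional B (\<lambda>b. pairing B \<phi> (lact a b))"

definition dual_lact :: "('k::real_normed_field, 'v) nspace \<Rightarrow> ('v \<Rightarrow> 'u \<Rightarrow> 'v) \<Rightarrow> 'u \<Rightarrow> 'v \<Rightarrow> 'v" where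
  "dual_lact B ract a \<phi> = functional B (\<lambda>b. pairing B \<phi> (ract b a))"


section \<open>Topological centers\<close>

text \<open>The order \<open>n\<close> is even and at least 2. The first two sets are subsets of \<open>B\<^bsup>(n+1)\<^esup>\<close>, the
  other two of \<open>B\<^bsup>(n)\<^esup>\<close>; \<open>lact\<close> and \<open>ract\<close> are the actions of \<open>A\<close> on \<open>B\<close>.\<close>

definition Z_left :: "nat \<Rightarrow> ('k::real_normed_field, 'u) nspace \<Rightarrow> ('k, 'v) nspace \<Rightarrow>
    ('u \<Rightarrow> 'v \<Rightarrow> 'v) \<Rightarrow> 'v set" where
  "Z_left n A B lact = {\<phi> \<in> carrier (ndual (n + 1) B).
     continuous_map (weak_star (ndual (n - 1) A)) (weak_star (ndual n B))
       (\<lambda>a. dual_ract (ndual n B) (nlact n A B lact) \<phi> a)}"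

definition Z_right :: "nat \<Rightarrow> ('k::real_normed_field, 'u) nspace \<Rightarrow> ('k, 'v) nspace \<Rightarrow>
    ('v \<Rightarrow> 'u \<Rightarrow> 'v) \<Rightarrow> 'v set" where
  "Z_right n A B ract = {\<phi> \<in> carrier (ndual (n + 1) B).
     continuous_map (weak_star (ndual (n - 1) A)) (weak_star (ndual n B))
       (\<lambda>a. dual_lact (ndual n B) (nract n A B ract) a \<phi>)}"

definition Zt_left :: "nat \<Rightarrow> ('k::real_normed_field, 'u) nspace \<Rightarrow> ('k, 'v) nspace \<Rightarrow>
    ('v \<Rightarrow> 'u \<Rightarrow> 'v) \<Rightarrow> 'v set" where
  "Zt_left n A B ract = {b \<in> carrier (ndual n B).
     continuous_map (weak_star (ndual (n - 1) A)) (weak_topology (ndual n B))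
       (\<lambda>a. nract n A B ract b a)}"

definition Zt_right :: "nat \<Rightarrow> ('k::real_normed_field, 'u) nspace \<Rightarrow> ('k, 'v) nspace \<Rightarrow>
    ('u \<Rightarrow> 'v \<Rightarrow> 'v) \<Rightarrow> 'v set" where
  "Zt_right n A B lact = {b \<in> carrier (ndual n B).
     continuous_map (weak_star (ndual (n - 1) A)) (weak_topology (ndual n B))
       (\<lambda>a. nlact n A B lact a b)}"

end

theory Submission
  imports Defs
begin

text \<open>
  Writing \<open>a b\<close> for the action, both equalities of centers assert that \<open>a \<mapsto> \<langle>\<phi>, a b\<rangle>\<close> is weak*
  continuous for all \<open>\<phi> \<in> B\<^bsup>(n+1)\<^esup>\<close> and \<open>b \<in> B\<^bsup>(n)\<^esup>\<close>, once the actions on the iterated duals are known to be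
  bounded bilinear maps. That holds because the iterated limit defining the Arens extension of a
  bounded bilinear \<open>m\<close> always exists and equals \<open>\<psi> \<mapsto> \<langle>x, u \<mapsto> \<langle>y, v \<mapsto> \<langle>\<psi>, m u v\<rangle>\<rangle>\<rangle>\<close>. Uniqueness of the
  limit needs nets that converge to given points of the bidual; since these nets may be unbounded,
  linear algebra (a functional on the dual agrees on finitely many functionals with a point of the
  space) replaces the theorems of Hahn--Banach and Goldstine.
\<close>

section \<open>Duality\<close>

text \<open>The properties of a Banach space that duality relies on; completeness and the triangle
  inequality are not among them, and what remains visibly passes to duals.\<close>

locale pre_normed =
  fixes X :: "('k::real_normed_field, 'u) nspace" (structure)
  assumes nonempty: "carrier X \<noteq> {}"
    and add_closed [simp]: "\<lbrakk>x \<in> carrier X; y \<in> carrier X\<rbrakk> \<Longrightarrow> x \<oplus> y \<in> carrier X"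
    and smult_closed [simp]: "x \<in> carrier X \<Longrightarrow> c \<odot> x \<in> carrier X"
    and nrm_nonneg [simp]: "x \<in> carrier X \<Longrightarrow> 0 \<le> nrm X x"
    and nrm_smult_le: "x \<in> carrier X \<Longrightarrow> nrm X (c \<odot> x) \<le> norm c * nrm X x"

text \<open>The clause that takes an argument is nonnegativity of the norm: the triangle inequality
  applied to \<open>x \<oplus> \<ominus> x\<close>, which has norm \<open>0\<close>, gives
  \<open>0 \<le> 2 * nrm X x\<close>.\<close>

lemma (in banach_space) pre_normed: "pre_normed X"
proof
  show "carrier X \<noteq> {}" by auto
  fix x assume x: "x \<in> carrier X"
  \<comment> \<open>Homogeneity of the norm speaks of scalars, so the additive inverse has to be
    recognised as the multiple by \<open>- 1\<close>.\<close>
  have neg: "(- 1) \<odot> x = \<ominus> x"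
    using smult_l_minus [of 1 x] smult_one x
    by (metis R.add.inv_equality R.one_closed UNIV_I add.left_inverse partial_object.select_convs(1)
        ring_record_simps(12) scalars_def monoid.select_convs(2) ring_record_simps(11))
  have "0 = nrm X (x \<oplus> \<ominus> x)"
    using nrm_eq_0_iff x by (simp add: M.r_neg)
  also have "\<dots> \<le> nrm X x + nrm X (\<ominus> x)"
    using x by (intro nrm_add_le) auto
  also have "\<dots> = 2 * nrm X x"
    using nrm_smult [OF x, of "- 1"] neg by simp
  finally show "0 \<le> nrm X x" by simp
qed (auto simp: nrm_smult scalars_def intro: smult_closed [unfolded scalars_def, simplified])

text \<open>Linearity alone, so that it applies to formulas not yet restricted to the carrier and to
  forms on the dual without a bound.\<close>

definition linear_form :: "('k::real_normed_field, 'u) nspace \<Rightarrow> ('u \<Rightarrow> 'k) \<Rightarrow> bool" where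
  "linear_form X f \<longleftrightarrow>
     (\<forall>x\<in>carrier X. \<forall>y\<in>carrier X. f (x \<oplus>\<^bsub>X\<^esub> y) = f x + f y) \<and>
     (\<forall>c. \<forall>x\<in>carrier X. f (c \<odot>\<^bsub>X\<^esub> x) = c * f x)"

text \<open>The cardinality condition makes the choice in \<open>encode\<close> an actual injection,
  so that \<open>pairing\<close> decodes what \<open>encode\<close> produces.\<close>

locale dualizable = pre_normed X for X :: "('k::real_normed_field, 'u) nspace" (structure) +
  assumes functionals_lepoll: "functionals X \<lesssim> (UNIV :: 'u set)"
begin

lemma inj_on_encode: "inj_on (encode X) (functionals X)"
  using functionals_lepoll unfolding lepoll_def encode_def by (metis someI_ex)

lemma pairing_encode: "f \<in> functionals X \<Longrightarrow> pairing X (encode X f) = f"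
  by (simp add: pairing_def inj_on_encode)

lemma pairing_in_functionals: "\<phi> \<in> carrier (dual X) \<Longrightarrow> pairing X \<phi> \<in> functionals X"
  by (auto simp: dual_def pairing_encode)

lemma encode_pairing: "\<phi> \<in> carrier (dual X) \<Longrightarrow> encode X (pairing X \<phi>) = \<phi>"
  by (auto simp: dual_def pairing_encode)

lemma pairing_add_right [simp]:
  "\<lbrakk>\<phi> \<in> carrier (dual X); x \<in> carrier X; y \<in> carrier X\<rbrakk> \<Longrightarrow>
    pairing X \<phi> (x \<oplus> y) = pairing X \<phi> x + pairing X \<phi> y"
  using pairing_in_functionals by (auto simp: functionals_def)

lemma pairing_smult_right [simp]:
  "\<lbrakk>\<phi> \<in> carrier (dual X); x \<in> carrier X\<rbrakk> \<Longrightarrow> pairing X \<phi> (c \<odot> x) = c * pairing X \<phi> x"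
  using pairing_in_functionals by (auto simp: functionals_def)

lemma pairing_bounded:
  "\<phi> \<in> carrier (dual X) \<Longrightarrow> \<exists>K. \<forall>x\<in>carrier X. norm (pairing X \<phi> x) \<le> K * nrm X x"
  using pairing_in_functionals by (auto simp: functionals_def)

text \<open>Bounded functionals are extensional, so agreement on the carrier makes the decoded
  functions equal; encoding then returns the two points.\<close>

lemma dual_eqI:
  assumes "\<phi> \<in> carrier (dual X)" "\<psi> \<in> carrier (dual X)"
    and "\<And>x. x \<in> carrier X \<Longrightarrow> pairing X \<phi> x = pairing X \<psi> x"
  shows "\<phi> = \<psi>"
proof -
  have "pairing X \<phi> = pairing X \<psi>"
    using assms pairing_in_functionals
    by (intro extensionalityI [of _ "carrier X"]) (auto simp: functionals_def)
  then show ?thesis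
    using assms encode_pairing by metis
qed

context
  fixes f K
  assumes f: "linear_form X f" "\<And>x. x \<in> carrier X \<Longrightarrow> norm (f x) \<le> K * nrm X x"
begin

lemma restrict_in_functionals: "restrict f (carrier X) \<in> functionals X"
  using f by (auto simp: functionals_def linear_form_def)

lemma functional_closed: "functional X f \<in> carrier (dual X)"
  using restrict_in_functionals by (auto simp: functional_def dual_def)

lemma pairing_functional: "x \<in> carrier X \<Longrightarrow> pairing X (functional X f) x = f x"
  using restrict_in_functionals by (simp add: functional_def pairing_encode)

end

section \<open>The dual norm\<close>

lemma norm_pairing_le:
  assumes "\<phi> \<in> carrier (dual X)" "x \<in> carrier X"
  shows "norm (pairing X \<phi> x) \<le> nrm (dual X) \<phi> * nrm X x"
proof -
  obtain K where K: "norm (pairing X \<phi> x) \<le> K * nrm X x" if "x \<in> carrier X" for x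
    using pairing_bounded assms(1) by blast
  show ?thesis
  proof (cases "nrm X x = 0")
    \<comment> \<open>A vector of norm \<open>0\<close> cannot be normalised, but any bound
      \<open>K\<close> forces its pairing to vanish.\<close>
    case True
    then show ?thesis using K [OF assms(2)] by simp
  next
    case False
    then have pos: "nrm X x > 0" using assms(2) by (simp add: less_le)
    let ?x = "of_real (1 / nrm X x) \<odot> x"
    have "nrm X ?x \<le> norm (of_real (1 / nrm X x) :: 'k) * nrm X x"
      using nrm_smult_le assms(2) by blast
    then have x: "?x \<in> {x \<in> carrier X. nrm X x \<le> 1}"
      using pos assms(2) by (simp add: norm_divide)
    \<comment> \<open>A supremum of reals dominates its members only if they are bounded above. The
      sign of \<open>K\<close> is unknown, hence \<open>\<bar>K\<bar>\<close>.\<close>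
    have "norm (pairing X \<phi> y) \<le> \<bar>K\<bar>" if "y \<in> carrier X" "nrm X y \<le> 1" for y
    proof -
      have "norm (pairing X \<phi> y) \<le> \<bar>K\<bar> * nrm X y"
        using K [OF that(1)] mult_right_mono [of K "\<bar>K\<bar>" "nrm X y"] that(1) by force
      also have "\<dots> \<le> \<bar>K\<bar> * 1" using that by (intro mult_left_mono) auto
      finally show ?thesis by simp
    qed
    then have "bdd_above ((\<lambda>x. norm (pairing X \<phi> x)) ` {x \<in> carrier X. nrm X x \<le> 1})"
      by (intro bdd_aboveI2 [of _ _ "\<bar>K\<bar>"]) auto
    then have "norm (pairing X \<phi> ?x) \<le> nrm (dual X) \<phi>"
      unfolding dual_def using x by (auto intro: cSUP_upper2)
    then show ?thesis
      using assms pos by (simp add: norm_divide field_simps)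
  qed
qed

text \<open>The point \<open>0 \<odot> x\<close> has norm at most \<open>0\<close>. This keeps the
  supremum in the dual norm from ranging over the empty set.\<close>

lemma unit_ball_nonempty: "{x \<in> carrier X. nrm X x \<le> 1} \<noteq> {}"
proof -
  obtain x where x: "x \<in> carrier X" using nonempty by blast
  then have "nrm X (0 \<odot> x) \<le> 0" using nrm_smult_le [of x 0] by simp
  then have "0 \<odot> x \<in> {x \<in> carrier X. nrm X x \<le> 1}" using x by simp
  then show ?thesis by blast
qed

lemma nrm_dual_le:
  assumes "C \<ge> 0" "\<And>x. x \<in> carrier X \<Longrightarrow> norm (pairing X \<phi> x) \<le> C * nrm X x"
  shows "nrm (dual X) \<phi> \<le> C"
proof -
  have "norm (pairing X \<phi> x) \<le> C" if "x \<in> carrier X" "nrm X x \<le> 1" for x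
    using assms(2) [OF that(1)] mult_left_mono [OF that(2) assms(1)] by simp
  then show ?thesis
    unfolding dual_def using unit_ball_nonempty by (auto intro!: cSUP_least)
qed

text \<open>A vector of positive norm makes the dual norm a factor of a nonnegative product whose
  other factor is positive. If there is no such vector, all pairings are \<open>0\<close> and the
  supremum is that of a constant.\<close>

lemma nrm_dual_nonneg: "\<phi> \<in> carrier (dual X) \<Longrightarrow> 0 \<le> nrm (dual X) \<phi>"
proof -
  assume \<phi>: "\<phi> \<in> carrier (dual X)"
  show ?thesis
  proof (cases "\<exists>x\<in>carrier X. nrm X x > 0")
    case True
    then obtain x where "x \<in> carrier X" "nrm X x > 0" by blast
    then show ?thesis
      using norm_pairing_le [OF \<phi>, of x] by (smt (verit) norm_ge_zero zero_le_mult_iff)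
  next
    case False
    have "pairing X \<phi> x = 0" if "x \<in> carrier X" for x
      using norm_pairing_le [OF \<phi> that] False nrm_nonneg [OF that] that
      by (metis mult_zero_right norm_le_zero_iff order_le_less)
    then have "nrm (dual X) \<phi> = (SUP x\<in>{x \<in> carrier X. nrm X x \<le> 1}. 0)"
      unfolding dual_def by (auto intro!: SUP_cong)
    then show ?thesis using unit_ball_nonempty by (simp add: cSUP_const)
  qed
qed

section \<open>The dual as a normed space\<close>

lemma linear_form_add:
  "\<lbrakk>\<phi> \<in> carrier (dual X); \<psi> \<in> carrier (dual X)\<rbrakk> \<Longrightarrow>
    linear_form X (\<lambda>x. pairing X \<phi> x + pairing X \<psi> x)"
  by (auto simp: linear_form_def algebra_simps)

lemma linear_form_smult:
  "\<phi> \<in> carrier (dual X) \<Longrightarrow> linear_form X (\<lambda>x. c * pairing X \<phi> x)"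
  by (auto simp: linear_form_def algebra_simps)

lemma norm_add_pairing_le:
  assumes "\<phi> \<in> carrier (dual X)" "\<psi> \<in> carrier (dual X)" "x \<in> carrier X"
  shows "norm (pairing X \<phi> x + pairing X \<psi> x) \<le> (nrm (dual X) \<phi> + nrm (dual X) \<psi>) * nrm X x"
  using norm_triangle_ineq [of "pairing X \<phi> x" "pairing X \<psi> x"]
    norm_pairing_le [OF assms(1,3)] norm_pairing_le [OF assms(2,3)]
  by (simp add: algebra_simps)

lemma norm_smult_pairing_le:
  assumes "\<phi> \<in> carrier (dual X)" "x \<in> carrier X"
  shows "norm (c * pairing X \<phi> x) \<le> (norm c * nrm (dual X) \<phi>) * nrm X x"
  using mult_left_mono [OF norm_pairing_le [OF assms], of "norm c"]
  by (simp add: norm_mult mult.assoc)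

lemma dual_add_closed:
  "\<lbrakk>\<phi> \<in> carrier (dual X); \<psi> \<in> carrier (dual X)\<rbrakk> \<Longrightarrow> \<phi> \<oplus>\<^bsub>dual X\<^esub> \<psi> \<in> carrier (dual X)"
  using functional_closed [OF linear_form_add norm_add_pairing_le] by (simp add: dual_def)

lemma dual_smult_closed:
  "\<phi> \<in> carrier (dual X) \<Longrightarrow> c \<odot>\<^bsub>dual X\<^esub> \<phi> \<in> carrier (dual X)"
  using functional_closed [OF linear_form_smult norm_smult_pairing_le] by (simp add: dual_def)

lemma pairing_add_left [simp]:
  "\<lbrakk>\<phi> \<in> carrier (dual X); \<psi> \<in> carrier (dual X); x \<in> carrier X\<rbrakk> \<Longrightarrow>
    pairing X (\<phi> \<oplus>\<^bsub>dual X\<^esub> \<psi>) x = pairing X \<phi> x + pairing X \<psi> x"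
  using pairing_functional [OF linear_form_add norm_add_pairing_le] by (simp add: dual_def)

lemma pairing_smult_left [simp]:
  "\<lbrakk>\<phi> \<in> carrier (dual X); x \<in> carrier X\<rbrakk> \<Longrightarrow>
    pairing X (c \<odot>\<^bsub>dual X\<^esub> \<phi>) x = c * pairing X \<phi> x"
  using pairing_functional [OF linear_form_smult norm_smult_pairing_le] by (simp add: dual_def)

text \<open>The inductive step for iterated duals: the locale axioms reproduce themselves, the norm
  estimate coming from the pointwise bound on \<open>c * pairing X \<phi> x\<close>.\<close>

lemma pre_normed_dual: "pre_normed (dual X)"
proof
  have "functional X (\<lambda>x. 0) \<in> carrier (dual X)"
    by (rule functional_closed [of _ 0]) (auto simp: linear_form_def)
  then show "carrier (dual X) \<noteq> {}" by blast
  fix \<phi> c assume \<phi>: "\<phi> \<in> carrier (dual X)"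
  show "nrm (dual X) (c \<odot>\<^bsub>dual X\<^esub> \<phi>) \<le> norm c * nrm (dual X) \<phi>"
    using \<phi> norm_smult_pairing_le nrm_dual_nonneg by (intro nrm_dual_le) auto
qed (auto simp: dual_add_closed dual_smult_closed nrm_dual_nonneg)

end

sublocale dualizable \<subseteq> dual: pre_normed "dual X"
  by (rule pre_normed_dual)


section \<open>Weak topologies\<close>

text \<open>A subbase decides convergence, because eventual membership survives the finite
  intersections and the unions by which the open sets are generated.\<close>

lemma limitin_topology_generated_by:
  "limitin (topology_generated_by S) f l F \<longleftrightarrow>
     l \<in> \<Union>S \<and> (\<forall>V\<in>S. l \<in> V \<longrightarrow> (\<forall>\<^sub>F u in F. f u \<in> V))" (is "?L \<longleftrightarrow> ?R")
proof
  assume ?L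
  then show ?R
    by (auto simp: limitin_def intro: topology_generated_by_Basis)
next
  assume R: ?R
  have "l \<in> U \<longrightarrow> (\<forall>\<^sub>F u in F. f u \<in> U)" if "generate_topology_on S U" for U
    using that
  proof induction
    case (UN K)
    show ?case
    proof
      assume "l \<in> \<Union>K"
      then obtain k where k: "k \<in> K" "l \<in> k" by blast
      then have "\<forall>\<^sub>F u in F. f u \<in> k" using UN by blast
      then show "\<forall>\<^sub>F u in F. f u \<in> \<Union>K" using k by (auto elim: eventually_mono)
    qed
  qed (use R in \<open>auto intro: eventually_conj\<close>)
  with R show ?L
    by (auto simp: limitin_def openin_topology_generated_by_iff)
qed

text \<open>For a single index the preimage of \<open>UNIV\<close> is already all of
  \<open>C\<close>; with no index the generated space would be empty.\<close>

lemma Union_preimages: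
  fixes g :: "'i \<Rightarrow> 'a \<Rightarrow> 'b::topological_space"
  assumes "I \<noteq> {}"
  shows "\<Union>{{x \<in> C. g i x \<in> U} | i U. i \<in> I \<and> open U} = C"
proof -
  obtain i where "i \<in> I" using assms by blast
  then have "{x \<in> C. g i x \<in> UNIV} \<in> {{x \<in> C. g i x \<in> U} | i U. i \<in> I \<and> open U}"
    using open_UNIV by blast
  then have "C \<subseteq> \<Union>{{x \<in> C. g i x \<in> U} | i U. i \<in> I \<and> open U}"
    by (intro Union_upper) simp
  then show ?thesis by blast
qed

text \<open>The weak and the weak* topology are both initial topologies, differing in whether the
  maps \<open>g i\<close> evaluate a fixed functional or evaluate at a fixed point. One statement
  serves both.\<close>

lemma limitin_generated_by_preimages_iff:
  fixes g :: "'i \<Rightarrow> 'a \<Rightarrow> 'b::topological_space"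
  assumes "I \<noteq> {}" and ev: "\<forall>\<^sub>F u in F. f u \<in> C"
  shows "limitin (topology_generated_by {{x \<in> C. g i x \<in> U} | i U. i \<in> I \<and> open U}) f l F \<longleftrightarrow>
    l \<in> C \<and> (\<forall>i\<in>I. ((\<lambda>u. g i (f u)) \<longlongrightarrow> g i l) F)"
    (is "limitin (topology_generated_by ?S) f l F \<longleftrightarrow> _")
proof (cases "l \<in> C")
  case True
  have "(\<forall>V\<in>?S. Q V) \<longleftrightarrow> (\<forall>i\<in>I. \<forall>U. open U \<longrightarrow> Q {x \<in> C. g i x \<in> U})" for Q
    by blast
  then show ?thesis
    using True ev
    unfolding limitin_topology_generated_by Union_preimages [OF assms(1)] tendsto_def
    by (simp add: eventually_conj_iff)
next
  case False
  then show ?thesis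
    unfolding limitin_topology_generated_by Union_preimages [OF assms(1)] by simp
qed

lemma continuous_map_generated_by_preimages_iff:
  fixes g :: "'i \<Rightarrow> 'a \<Rightarrow> 'b::topological_space"
  assumes "I \<noteq> {}"
  shows "continuous_map T (topology_generated_by {{x \<in> C. g i x \<in> U} | i U. i \<in> I \<and> open U}) f \<longleftrightarrow>
    f \<in> topspace T \<rightarrow> C \<and> (\<forall>i\<in>I. continuous_map T euclidean (\<lambda>a. g i (f a)))"
    (is "continuous_map T (topology_generated_by ?S) f \<longleftrightarrow> _")
proof (cases "f \<in> topspace T \<rightarrow> C")
  case True
  have preimage: "f -` {x \<in> C. g i x \<in> U} \<inter> topspace T = {a \<in> topspace T. g i (f a) \<in> U}" for i U
    using True by auto
  have "(\<forall>V. V \<in> ?S \<longrightarrow> openin T (f -` V \<inter> topspace T)) \<longleftrightarrow>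
      (\<forall>i\<in>I. \<forall>U. open U \<longrightarrow> openin T (f -` {x \<in> C. g i x \<in> U} \<inter> topspace T))"
    by blast
  then show ?thesis
    using True unfolding preimage continuous_on_generated_topo_iff Union_preimages [OF assms]
    by (simp add: continuous_map_def image_subset_iff_funcset)
next
  case False
  then show ?thesis
    unfolding continuous_on_generated_topo_iff Union_preimages [OF assms]
    by (simp add: image_subset_iff_funcset)
qed

section \<open>Weak topologies tested by pairings\<close>

context dualizable
begin

lemma topspace_weak_star: "topspace (weak_star X) = carrier (dual X)"
  unfolding weak_star_def topology_generated_by_topspace by (rule Union_preimages [OF nonempty])

lemma limitin_weak_star:
  assumes "\<forall>\<^sub>F u in F. f u \<in> carrier (dual X)"
  shows "limitin (weak_star X) f \<phi> F \<longleftrightarrow>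
    \<phi> \<in> carrier (dual X) \<and> (\<forall>x\<in>carrier X. ((\<lambda>u. pairing X (f u) x) \<longlongrightarrow> pairing X \<phi> x) F)"
  unfolding weak_star_def
  using limitin_generated_by_preimages_iff [OF nonempty assms, of "\<lambda>x \<phi>. pairing X \<phi> x" \<phi>] .

lemma continuous_map_weak_star_iff:
  "continuous_map T (weak_star X) f \<longleftrightarrow>
    f \<in> topspace T \<rightarrow> carrier (dual X) \<and>
    (\<forall>x\<in>carrier X. continuous_map T euclidean (\<lambda>a. pairing X (f a) x))"
  unfolding weak_star_def
  using continuous_map_generated_by_preimages_iff [OF nonempty, of T "carrier (dual X)" "\<lambda>x \<phi>. pairing X \<phi> x" f] .

lemma continuous_map_weak_topology_iff:
  "continuous_map T (weak_topology X) f \<longleftrightarrow>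
    f \<in> topspace T \<rightarrow> carrier X \<and>
    (\<forall>\<phi>\<in>carrier (dual X). continuous_map T euclidean (\<lambda>a. pairing X \<phi> (f a)))"
  unfolding weak_topology_def
  using continuous_map_generated_by_preimages_iff [OF dual.nonempty, of T "carrier X" "pairing X" f] .

text \<open>Weak* continuity tests a functional at every \<open>b\<close>, weak continuity tests a
  vector against every \<open>\<phi>\<close>; after transposition both test
  \<open>pairing X \<phi> (m a b)\<close> for all pairs. Linearity and boundedness of
  \<open>m a\<close> ensure that the transposed formula is a point of the dual.\<close>

lemma continuous_weak_star_transpose_iff:
  assumes linear: "\<And>a. a \<in> topspace T \<Longrightarrow> linear_map X X (m a)"
    and bounded: "\<And>a. a \<in> topspace T \<Longrightarrow> \<exists>K\<ge>0. \<forall>b\<in>carrier X. nrm X (m a b) \<le> K * nrm X b"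
  shows "(\<forall>\<phi>\<in>carrier (dual X).
      continuous_map T (weak_star X) (\<lambda>a. functional X (\<lambda>b. pairing X \<phi> (m a b)))) \<longleftrightarrow>
    (\<forall>b\<in>carrier X. continuous_map T (weak_topology X) (\<lambda>a. m a b))"
proof -
  have closed: "m a b \<in> carrier X" if "a \<in> topspace T" "b \<in> carrier X" for a b
    using linear [OF that(1)] that(2) by (auto simp: linear_map_def)
  have form: "linear_form X (\<lambda>b. pairing X \<phi> (m a b))"
    if "\<phi> \<in> carrier (dual X)" "a \<in> topspace T" for \<phi> a
    using linear [OF that(2)] that(1) closed [OF that(2)] by (auto simp: linear_map_def linear_form_def)
  have bound: "\<exists>K. \<forall>b\<in>carrier X. norm (pairing X \<phi> (m a b)) \<le> K * nrm X b"
    if \<phi>: "\<phi> \<in> carrier (dual X)" and a: "a \<in> topspace T" for \<phi> a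
  proof -
    obtain K where K: "\<forall>b\<in>carrier X. nrm X (m a b) \<le> K * nrm X b"
      using bounded [OF a] by blast
    have "norm (pairing X \<phi> (m a b)) \<le> nrm (dual X) \<phi> * K * nrm X b" if "b \<in> carrier X" for b
      using norm_pairing_le [OF \<phi> closed [OF a that]] K that
        mult_left_mono [of "nrm X (m a b)" "K * nrm X b" "nrm (dual X) \<phi>"] \<phi>
      by (force simp: mult.assoc)
    then show ?thesis by blast
  qed
  have closed': "functional X (\<lambda>b. pairing X \<phi> (m a b)) \<in> carrier (dual X)"
    if "\<phi> \<in> carrier (dual X)" "a \<in> topspace T" for \<phi> a
    using functional_closed [OF form [OF that]] bound [OF that] by blast
  \<comment> \<open>The encoded functional evaluates to its formula for \<open>a\<close> in the
    space of \<open>T\<close>, and continuity from \<open>T\<close> depends on these points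
    alone.\<close>
  have eq: "continuous_map T euclidean (\<lambda>a. pairing X (functional X (\<lambda>b. pairing X \<phi> (m a b))) x)
      \<longleftrightarrow> continuous_map T euclidean (\<lambda>a. pairing X \<phi> (m a x))"
    if \<phi>: "\<phi> \<in> carrier (dual X)" and x: "x \<in> carrier X" for \<phi> x
  proof -
    have "pairing X (functional X (\<lambda>b. pairing X \<phi> (m a b))) x = pairing X \<phi> (m a x)"
      if "a \<in> topspace T" for a
      using bound [OF \<phi> that] pairing_functional [OF form [OF \<phi> that] _ x] by blast
    then show ?thesis
      using continuous_map_eq by (metis (no_types, lifting))
  qed
  show ?thesis
    using closed closed' eq
    by (simp add: continuous_map_weak_star_iff continuous_map_weak_topology_iff Pi_iff) blast
qed

end


section \<open>Weak* density\<close>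

locale bidualizable = dualizable X + dual: dualizable "dual X"
  for X :: "('k::real_normed_field, 'u) nspace" (structure)
begin

lemma canonical_closed: "x \<in> carrier X \<Longrightarrow> canonical X x \<in> carrier (dual (dual X))"
  and pairing_canonical [simp]:
    "\<lbrakk>x \<in> carrier X; \<phi> \<in> carrier (dual X)\<rbrakk> \<Longrightarrow> pairing (dual X) (canonical X x) \<phi> = pairing X \<phi> x"
proof -
  assume x: "x \<in> carrier X"
  have *: "linear_form (dual X) (\<lambda>\<phi>. pairing X \<phi> x)"
    using x by (auto simp: linear_form_def)
  have **: "norm (pairing X \<phi> x) \<le> nrm X x * nrm (dual X) \<phi>" if "\<phi> \<in> carrier (dual X)" for \<phi>
    using norm_pairing_le [OF that x] by (simp add: mult.commute)
  show "canonical X x \<in> carrier (dual (dual X))"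
    unfolding canonical_def using dual.functional_closed [OF * **] .
  show "pairing (dual X) (canonical X x) \<phi> = pairing X \<phi> x" if "\<phi> \<in> carrier (dual X)"
    unfolding canonical_def using dual.pairing_functional [OF * ** that] .
qed

text \<open>Algebraically, a functional vanishing on the common kernel of finitely many others lies
  in their span. Quantifying over a form \<open>L\<close> that is zero on \<open>S\<close> expresses
  this without mentioning spans.\<close>

lemma linear_form_vanishes:
  assumes "finite S" "S \<subseteq> carrier (dual X)" "linear_form (dual X) L" "\<And>\<psi>. \<psi> \<in> S \<Longrightarrow> L \<psi> = 0"
    and "\<phi> \<in> carrier (dual X)"
    and "\<And>x. \<lbrakk>x \<in> carrier X; \<And>\<psi>. \<psi> \<in> S \<Longrightarrow> pairing X \<psi> x = 0\<rbrakk> \<Longrightarrow> pairing X \<phi> x = 0"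
  shows "L \<phi> = 0"
  using assms
proof (induction S arbitrary: \<phi>)
  \<comment> \<open>Here \<open>\<phi>\<close> vanishes on the whole carrier, hence equals
    \<open>0 \<odot>\<phi>\<close>, and homogeneity of \<open>L\<close> gives
    \<open>0\<close>.\<close>
  case empty
  have "0 \<odot>\<^bsub>dual X\<^esub> \<phi> = \<phi>"
    using empty by (intro dual_eqI) auto
  then show ?case
    using empty unfolding linear_form_def by (metis mult_zero_left)
next
  case (insert \<theta> S)
  have \<theta>: "\<theta> \<in> carrier (dual X)" "L \<theta> = 0" and S: "S \<subseteq> carrier (dual X)"
    and L: "linear_form (dual X) L" "\<And>\<psi>. \<psi> \<in> S \<Longrightarrow> L \<psi> = 0" and \<phi>: "\<phi> \<in> carrier (dual X)"
    using insert.prems by auto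
  have kernel: "pairing X \<phi> x = 0"
    if "x \<in> carrier X" "\<And>\<psi>. \<psi> \<in> S \<Longrightarrow> pairing X \<psi> x = 0" "pairing X \<theta> x = 0" for x
    using that by (intro insert.prems(5)) blast+
  show ?case
  proof (cases "\<exists>v\<in>carrier X. (\<forall>\<psi>\<in>S. pairing X \<psi> v = 0) \<and> pairing X \<theta> v \<noteq> 0")
    case False
    then show ?thesis
      using kernel by (intro insert.IH [OF S L \<phi>]) blast+
  next
    case True
    then obtain v where v: "v \<in> carrier X" "\<And>\<psi>. \<psi> \<in> S \<Longrightarrow> pairing X \<psi> v = 0" "pairing X \<theta> v \<noteq> 0"
      by blast
    \<comment> \<open>Chosen so that \<open>\<phi>\<close> plus \<open>c\<close> times
      \<open>\<theta>\<close> vanishes at \<open>v\<close>; this combination turns out to vanish on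
      the common kernel of \<open>S\<close>.\<close>
    define c where "c = - (pairing X \<phi> v / pairing X \<theta> v)"
    have "L (\<phi> \<oplus>\<^bsub>dual X\<^esub> (c \<odot>\<^bsub>dual X\<^esub> \<theta>)) = 0"
    proof (rule insert.IH [OF S L])
      show "\<phi> \<oplus>\<^bsub>dual X\<^esub> (c \<odot>\<^bsub>dual X\<^esub> \<theta>) \<in> carrier (dual X)"
        using \<phi> \<theta>(1) by simp
      fix x assume x: "x \<in> carrier X" "\<And>\<psi>. \<psi> \<in> S \<Longrightarrow> pairing X \<psi> x = 0"
      \<comment> \<open>Chosen so that \<open>x \<oplus> (d \<odot> v)\<close> is also killed by
        \<open>\<theta>\<close>; being a combination of \<open>x\<close> and \<open>v\<close>, it
        stays in the common kernel of \<open>S\<close>.\<close>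
      define d where "d = - (pairing X \<theta> x / pairing X \<theta> v)"
      have "pairing X \<phi> (x \<oplus> (d \<odot> v)) = 0"
      proof (rule kernel)
        show "pairing X \<psi> (x \<oplus> (d \<odot> v)) = 0" if "\<psi> \<in> S" for \<psi>
          using that S x(1) x(2) [OF that] v(1) v(2) [OF that] by (simp add: subset_iff)
        show "pairing X \<theta> (x \<oplus> (d \<odot> v)) = 0"
          using \<theta>(1) x(1) v(1,3) by (simp add: d_def)
      qed (use x(1) v(1) in simp)
      then have "pairing X \<phi> x + d * pairing X \<phi> v = 0"
        using \<phi> x(1) v(1) by simp
      moreover have "d * pairing X \<phi> v = c * pairing X \<theta> x"
        by (simp add: c_def d_def)
      ultimately show "pairing X (\<phi> \<oplus>\<^bsub>dual X\<^esub> (c \<odot>\<^bsub>dual X\<^esub> \<theta>)) x = 0"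
        using \<phi> \<theta>(1) x(1) by simp
    qed
    moreover have "L (\<phi> \<oplus>\<^bsub>dual X\<^esub> (c \<odot>\<^bsub>dual X\<^esub> \<theta>)) = L \<phi> + c * L \<theta>"
      using L(1) \<phi> \<theta>(1) by (simp add: linear_form_def)
    ultimately show ?thesis
      using \<theta>(2) by simp
  qed
qed

text \<open>Helly's lemma without control of the norm of \<open>u\<close>. A vector killed by
  \<open>S\<close> but not by \<open>\<theta>\<close> allows \<open>u\<close> to be corrected at
  \<open>\<theta>\<close>; if there is none, the value at \<open>\<theta>\<close> is determined by
  those on \<open>S\<close>.\<close>

lemma finite_interpolation:
  assumes "finite S" "S \<subseteq> carrier (dual X)" "x \<in> carrier (dual (dual X))"
  shows "\<exists>u\<in>carrier X. \<forall>\<phi>\<in>S. pairing X \<phi> u = pairing (dual X) x \<phi>"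
  using assms(1,2)
proof (induction S)
  case empty
  then show ?case using nonempty by auto
next
  case (insert \<theta> S)
  then obtain u where u: "u \<in> carrier X" "\<And>\<phi>. \<phi> \<in> S \<Longrightarrow> pairing X \<phi> u = pairing (dual X) x \<phi>"
    by auto
  have \<theta>: "\<theta> \<in> carrier (dual X)" and S: "S \<subseteq> carrier (dual X)" using insert.prems by auto
  show ?case
  proof (cases "\<exists>v\<in>carrier X. (\<forall>\<psi>\<in>S. pairing X \<psi> v = 0) \<and> pairing X \<theta> v \<noteq> 0")
    case True
    then obtain v where v: "v \<in> carrier X" "\<And>\<psi>. \<psi> \<in> S \<Longrightarrow> pairing X \<psi> v = 0" "pairing X \<theta> v \<noteq> 0"
      by blast
    \<comment> \<open>Solves \<open>pairing X \<theta> u + c * pairing X \<theta> v = pairing (dual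
      X) x \<theta>\<close>.\<close>
    define c where "c = (pairing (dual X) x \<theta> - pairing X \<theta> u) / pairing X \<theta> v"
    have "pairing X \<phi> (u \<oplus> c \<odot> v) = pairing (dual X) x \<phi>" if "\<phi> \<in> insert \<theta> S" for \<phi>
      using that u v \<theta> S by (cases "\<phi> = \<theta>") (auto simp: subset_iff c_def)
    then show ?thesis
      using u v by (intro bexI [of _ "u \<oplus> c \<odot> v"]) auto
  next
    case False
    \<comment> \<open>The error form vanishes on \<open>S\<close> by the choice of \<open>u\<close>,
      and \<open>\<theta>\<close> vanishes on the common kernel of \<open>S\<close>, so the error at
      \<open>\<theta>\<close> is zero too.\<close>
    have "pairing (dual X) x \<theta> - pairing X \<theta> u = 0"
    proof (rule linear_form_vanishes [of S "\<lambda>\<phi>. pairing (dual X) x \<phi> - pairing X \<phi> u"])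
      show "linear_form (dual X) (\<lambda>\<phi>. pairing (dual X) x \<phi> - pairing X \<phi> u)"
        using u assms(3) by (auto simp: linear_form_def algebra_simps)
    qed (use False insert.hyps S u \<theta> in auto)
    then show ?thesis using u by (intro bexI [of _ u]) auto
  qed
qed

section \<open>Nets converging to points of the bidual\<close>

lemma net_to_iff:
  "net_to X x F \<longleftrightarrow> F \<noteq> bot \<and> (\<forall>\<^sub>F u in F. u \<in> carrier X) \<and> x \<in> carrier (dual (dual X)) \<and>
    (\<forall>\<phi>\<in>carrier (dual X). ((\<lambda>u. pairing X \<phi> u) \<longlongrightarrow> pairing (dual X) x \<phi>) F)"
proof (cases "\<forall>\<^sub>F u in F. u \<in> carrier X")
  case True
  \<comment> \<open>Pairing with \<open>canonical X u\<close> is evaluation at \<open>u\<close> for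
    \<open>u\<close> in the carrier, hence eventually along \<open>F\<close>.\<close>
  have "((\<lambda>u. pairing (dual X) (canonical X u) \<phi>) \<longlongrightarrow> l) F \<longleftrightarrow> ((\<lambda>u. pairing X \<phi> u) \<longlongrightarrow> l) F"
    if "\<phi> \<in> carrier (dual X)" for \<phi> l
    using True that by (intro tendsto_cong) (auto elim: eventually_mono)
  moreover have "\<forall>\<^sub>F u in F. canonical X u \<in> carrier (dual (dual X))"
    using True by (auto elim: eventually_mono intro: canonical_closed)
  ultimately show ?thesis
    using True by (simp add: net_to_def dual.limitin_weak_star)
qed (simp add: net_to_def)

text \<open>The sets \<open>V S\<close> of exact interpolants of \<open>x\<close> on finite
  \<open>S\<close> form a filter base, since \<open>V (S \<union> T)\<close> lies in both
  \<open>V S\<close> and \<open>V T\<close>. Along the filter each functional is eventually constant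
  with the required value.\<close>

lemma net_to_exists:
  assumes x: "x \<in> carrier (dual (dual X))"
  shows "\<exists>F. net_to X x F"
proof -
  define V where "V S = {u \<in> carrier X. \<forall>\<phi>\<in>S. pairing X \<phi> u = pairing (dual X) x \<phi>}" for S
  define I where "I = {S. finite S \<and> S \<subseteq> carrier (dual X)}"
  define F where "F = (INF S\<in>I. principal (V S))"
  have ev: "eventually P F \<longleftrightarrow> (\<exists>S\<in>I. \<forall>u\<in>V S. P u)" for P
    unfolding F_def
  proof (subst eventually_INF_base)
    show "I \<noteq> {}" by (auto simp: I_def)
    fix S T assume "S \<in> I" "T \<in> I"
    then show "\<exists>R\<in>I. principal (V R) \<le> inf (principal (V S)) (principal (V T))"
      by (intro bexI [of _ "S \<union> T"]) (auto simp: V_def I_def)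
  qed (auto simp: eventually_principal)
  \<comment> \<open>Were \<open>F\<close> trivial, some \<open>V S\<close> would be empty, against
    finite interpolation.\<close>
  have "F \<noteq> bot"
    using finite_interpolation [OF _ _ x] ev [of "\<lambda>_. False"]
    by (force simp: trivial_limit_def V_def I_def)
  moreover have "\<forall>\<^sub>F u in F. u \<in> carrier X"
    unfolding ev by (intro bexI [of _ "{}"]) (auto simp: V_def I_def)
  moreover have "((\<lambda>u. pairing X \<phi> u) \<longlongrightarrow> pairing (dual X) x \<phi>) F" if "\<phi> \<in> carrier (dual X)" for \<phi>
  proof (rule tendsto_eventually)
    show "\<forall>\<^sub>F u in F. pairing X \<phi> u = pairing (dual X) x \<phi>"
      unfolding ev using that by (intro bexI [of _ "{\<phi>}"]) (auto simp: V_def I_def)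
  qed
  ultimately show ?thesis
    using x unfolding net_to_iff by blast
qed

end


section \<open>Arens extensions\<close>

lemma bounded_bilinear_map_nonneg_bound:
  assumes "bounded_bilinear_map X Y Z m" "pre_normed X" "pre_normed Y"
  shows "\<exists>K\<ge>0. \<forall>x\<in>carrier X. \<forall>y\<in>carrier Y. nrm Z (m x y) \<le> K * nrm X x * nrm Y y"
proof -
  interpret X: pre_normed X by fact
  interpret Y: pre_normed Y by fact
  obtain K where K: "nrm Z (m x y) \<le> K * nrm X x * nrm Y y" if "x \<in> carrier X" "y \<in> carrier Y" for x y
    using assms(1) unfolding bounded_bilinear_map_def by blast
  have "nrm Z (m x y) \<le> \<bar>K\<bar> * nrm X x * nrm Y y" if "x \<in> carrier X" "y \<in> carrier Y" for x y
  proof -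
    have "K * nrm X x * nrm Y y \<le> \<bar>K\<bar> * nrm X x * nrm Y y"
      using that by (intro mult_right_mono) auto
    then show ?thesis using K [OF that] by linarith
  qed
  then show ?thesis by (intro exI [of _ "\<bar>K\<bar>"]) auto
qed

locale arens_extension = X: bidualizable X + Y: bidualizable Y + Z: bidualizable Z
  for X :: "('k::real_normed_field, 'u) nspace" and Y :: "('k, 'v) nspace" and Z :: "('k, 'w) nspace" +
  fixes m :: "'u \<Rightarrow> 'v \<Rightarrow> 'w"
  assumes bilinear: "bounded_bilinear_map X Y Z m"
begin

lemma m_closed [simp]: "\<lbrakk>u \<in> carrier X; v \<in> carrier Y\<rbrakk> \<Longrightarrow> m u v \<in> carrier Z"
  and m_add_left [simp]: "\<lbrakk>u \<in> carrier X; u' \<in> carrier X; v \<in> carrier Y\<rbrakk> \<Longrightarrow>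
    m (u \<oplus>\<^bsub>X\<^esub> u') v = m u v \<oplus>\<^bsub>Z\<^esub> m u' v"
  and m_smult_left [simp]: "\<lbrakk>u \<in> carrier X; v \<in> carrier Y\<rbrakk> \<Longrightarrow>
    m (c \<odot>\<^bsub>X\<^esub> u) v = c \<odot>\<^bsub>Z\<^esub> m u v"
  and m_add_right [simp]: "\<lbrakk>u \<in> carrier X; v \<in> carrier Y; v' \<in> carrier Y\<rbrakk> \<Longrightarrow>
    m u (v \<oplus>\<^bsub>Y\<^esub> v') = m u v \<oplus>\<^bsub>Z\<^esub> m u v'"
  and m_smult_right [simp]: "\<lbrakk>u \<in> carrier X; v \<in> carrier Y\<rbrakk> \<Longrightarrow>
    m u (c \<odot>\<^bsub>Y\<^esub> v) = c \<odot>\<^bsub>Z\<^esub> m u v"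
  using bilinear unfolding bounded_bilinear_map_def linear_map_def by (blast | force)+

definition K :: real where
  "K = (SOME K. K \<ge> 0 \<and> (\<forall>u\<in>carrier X. \<forall>v\<in>carrier Y. nrm Z (m u v) \<le> K * nrm X u * nrm Y v))"

lemma K_nonneg: "K \<ge> 0"
  and nrm_m_le: "\<lbrakk>u \<in> carrier X; v \<in> carrier Y\<rbrakk> \<Longrightarrow> nrm Z (m u v) \<le> K * nrm X u * nrm Y v"
  using someI_ex [OF bounded_bilinear_map_nonneg_bound
      [OF bilinear X.pre_normed_axioms Y.pre_normed_axioms]]
  by (auto simp: K_def)

text \<open>The three successive adjoints by which Arens defined his product.\<close>

definition adj1 :: "'w \<Rightarrow> 'u \<Rightarrow> 'v" where
  "adj1 \<psi> u = functional Y (\<lambda>v. pairing Z \<psi> (m u v))"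

definition adj2 :: "'v \<Rightarrow> 'w \<Rightarrow> 'u" where
  "adj2 y \<psi> = functional X (\<lambda>u. pairing (dual Y) y (adj1 \<psi> u))"

definition adj3 :: "'u \<Rightarrow> 'v \<Rightarrow> 'w" where
  "adj3 x y = functional (dual Z) (\<lambda>\<psi>. pairing (dual X) x (adj2 y \<psi>))"

text \<open>These are the premises under which \<open>functional\<close> yields a point of the dual.
  The bound is explicit because it enters the bounds for \<open>adj2\<close> and \<open>adj3\<close>
  as a factor.\<close>

lemma adj1_aux:
  assumes "\<psi> \<in> carrier (dual Z)" "u \<in> carrier X"
  shows "linear_form Y (\<lambda>v. pairing Z \<psi> (m u v))"
    and "v \<in> carrier Y \<Longrightarrow> norm (pairing Z \<psi> (m u v)) \<le> (nrm (dual Z) \<psi> * K * nrm X u) * nrm Y v"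
proof -
  show "linear_form Y (\<lambda>v. pairing Z \<psi> (m u v))"
    using assms by (auto simp: linear_form_def)
  assume v: "v \<in> carrier Y"
  have "norm (pairing Z \<psi> (m u v)) \<le> nrm (dual Z) \<psi> * nrm Z (m u v)"
    using assms v by (intro Z.norm_pairing_le) auto
  also have "\<dots> \<le> nrm (dual Z) \<psi> * (K * nrm X u * nrm Y v)"
    using assms v nrm_m_le by (intro mult_left_mono) auto
  finally show "norm (pairing Z \<psi> (m u v)) \<le> (nrm (dual Z) \<psi> * K * nrm X u) * nrm Y v"
    by (simp add: mult.assoc)
qed

lemma adj1_closed [simp]:
  "\<lbrakk>\<psi> \<in> carrier (dual Z); u \<in> carrier X\<rbrakk> \<Longrightarrow> adj1 \<psi> u \<in> carrier (dual Y)"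
  unfolding adj1_def by (rule Y.functional_closed [OF adj1_aux])

lemma pairing_adj1 [simp]:
  "\<lbrakk>\<psi> \<in> carrier (dual Z); u \<in> carrier X; v \<in> carrier Y\<rbrakk> \<Longrightarrow> pairing Y (adj1 \<psi> u) v = pairing Z \<psi> (m u v)"
  unfolding adj1_def by (rule Y.pairing_functional [OF adj1_aux])

lemma nrm_adj1_le:
  "\<lbrakk>\<psi> \<in> carrier (dual Z); u \<in> carrier X\<rbrakk> \<Longrightarrow> nrm (dual Y) (adj1 \<psi> u) \<le> nrm (dual Z) \<psi> * K * nrm X u"
  using adj1_aux(2) K_nonneg by (intro Y.nrm_dual_le) auto

lemma adj1_add_left [simp]:
  "\<lbrakk>\<psi> \<in> carrier (dual Z); \<psi>' \<in> carrier (dual Z); u \<in> carrier X\<rbrakk> \<Longrightarrow>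
    adj1 (\<psi> \<oplus>\<^bsub>dual Z\<^esub> \<psi>') u = adj1 \<psi> u \<oplus>\<^bsub>dual Y\<^esub> adj1 \<psi>' u"
  by (rule Y.dual_eqI) auto

lemma adj1_smult_left [simp]:
  "\<lbrakk>\<psi> \<in> carrier (dual Z); u \<in> carrier X\<rbrakk> \<Longrightarrow>
    adj1 (c \<odot>\<^bsub>dual Z\<^esub> \<psi>) u = c \<odot>\<^bsub>dual Y\<^esub> adj1 \<psi> u"
  by (rule Y.dual_eqI) auto

lemma adj1_add_right [simp]:
  "\<lbrakk>\<psi> \<in> carrier (dual Z); u \<in> carrier X; u' \<in> carrier X\<rbrakk> \<Longrightarrow>
    adj1 \<psi> (u \<oplus>\<^bsub>X\<^esub> u') = adj1 \<psi> u \<oplus>\<^bsub>dual Y\<^esub> adj1 \<psi> u'"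
  by (rule Y.dual_eqI) auto

lemma adj1_smult_right [simp]:
  "\<lbrakk>\<psi> \<in> carrier (dual Z); u \<in> carrier X\<rbrakk> \<Longrightarrow>
    adj1 \<psi> (c \<odot>\<^bsub>X\<^esub> u) = c \<odot>\<^bsub>dual Y\<^esub> adj1 \<psi> u"
  by (rule Y.dual_eqI) auto

lemma adj2_aux:
  assumes "y \<in> carrier (dual (dual Y))" "\<psi> \<in> carrier (dual Z)"
  shows "linear_form X (\<lambda>u. pairing (dual Y) y (adj1 \<psi> u))"
    and "u \<in> carrier X \<Longrightarrow>
      norm (pairing (dual Y) y (adj1 \<psi> u)) \<le> (nrm (dual (dual Y)) y * nrm (dual Z) \<psi> * K) * nrm X u"
proof -
  show "linear_form X (\<lambda>u. pairing (dual Y) y (adj1 \<psi> u))"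
    using assms by (auto simp: linear_form_def)
  assume u: "u \<in> carrier X"
  have "norm (pairing (dual Y) y (adj1 \<psi> u)) \<le> nrm (dual (dual Y)) y * nrm (dual Y) (adj1 \<psi> u)"
    using assms u by (intro Y.dual.norm_pairing_le) auto
  also have "\<dots> \<le> nrm (dual (dual Y)) y * (nrm (dual Z) \<psi> * K * nrm X u)"
    using assms u nrm_adj1_le by (intro mult_left_mono) auto
  finally show "norm (pairing (dual Y) y (adj1 \<psi> u)) \<le>
      (nrm (dual (dual Y)) y * nrm (dual Z) \<psi> * K) * nrm X u"
    by (simp add: mult.assoc)
qed

lemma adj2_closed [simp]:
  "\<lbrakk>y \<in> carrier (dual (dual Y)); \<psi> \<in> carrier (dual Z)\<rbrakk> \<Longrightarrow> adj2 y \<psi> \<in> carrier (dual X)"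
  unfolding adj2_def by (rule X.functional_closed [OF adj2_aux])

lemma pairing_adj2 [simp]:
  "\<lbrakk>y \<in> carrier (dual (dual Y)); \<psi> \<in> carrier (dual Z); u \<in> carrier X\<rbrakk> \<Longrightarrow>
    pairing X (adj2 y \<psi>) u = pairing (dual Y) y (adj1 \<psi> u)"
  unfolding adj2_def by (rule X.pairing_functional [OF adj2_aux])

lemma nrm_adj2_le:
  "\<lbrakk>y \<in> carrier (dual (dual Y)); \<psi> \<in> carrier (dual Z)\<rbrakk> \<Longrightarrow>
    nrm (dual X) (adj2 y \<psi>) \<le> nrm (dual (dual Y)) y * nrm (dual Z) \<psi> * K"
  using adj2_aux(2) K_nonneg by (intro X.nrm_dual_le) auto

lemma adj2_add_left [simp]:
  "\<lbrakk>y \<in> carrier (dual (dual Y)); y' \<in> carrier (dual (dual Y)); \<psi> \<in> carrier (dual Z)\<rbrakk> \<Longrightarrow>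
    adj2 (y \<oplus>\<^bsub>dual (dual Y)\<^esub> y') \<psi> = adj2 y \<psi> \<oplus>\<^bsub>dual X\<^esub> adj2 y' \<psi>"
  by (rule X.dual_eqI) auto

lemma adj2_smult_left [simp]:
  "\<lbrakk>y \<in> carrier (dual (dual Y)); \<psi> \<in> carrier (dual Z)\<rbrakk> \<Longrightarrow>
    adj2 (c \<odot>\<^bsub>dual (dual Y)\<^esub> y) \<psi> = c \<odot>\<^bsub>dual X\<^esub> adj2 y \<psi>"
  by (rule X.dual_eqI) auto

lemma adj2_add_right [simp]:
  "\<lbrakk>y \<in> carrier (dual (dual Y)); \<psi> \<in> carrier (dual Z); \<psi>' \<in> carrier (dual Z)\<rbrakk> \<Longrightarrow>
    adj2 y (\<psi> \<oplus>\<^bsub>dual Z\<^esub> \<psi>') = adj2 y \<psi> \<oplus>\<^bsub>dual X\<^esub> adj2 y \<psi>'"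
  by (rule X.dual_eqI) auto

lemma adj2_smult_right [simp]:
  "\<lbrakk>y \<in> carrier (dual (dual Y)); \<psi> \<in> carrier (dual Z)\<rbrakk> \<Longrightarrow>
    adj2 y (c \<odot>\<^bsub>dual Z\<^esub> \<psi>) = c \<odot>\<^bsub>dual X\<^esub> adj2 y \<psi>"
  by (rule X.dual_eqI) auto

lemma adj3_aux:
  assumes "x \<in> carrier (dual (dual X))" "y \<in> carrier (dual (dual Y))"
  shows "linear_form (dual Z) (\<lambda>\<psi>. pairing (dual X) x (adj2 y \<psi>))"
    and "\<psi> \<in> carrier (dual Z) \<Longrightarrow> norm (pairing (dual X) x (adj2 y \<psi>)) \<le>
      (K * nrm (dual (dual X)) x * nrm (dual (dual Y)) y) * nrm (dual Z) \<psi>"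
proof -
  show "linear_form (dual Z) (\<lambda>\<psi>. pairing (dual X) x (adj2 y \<psi>))"
    using assms by (auto simp: linear_form_def)
  assume \<psi>: "\<psi> \<in> carrier (dual Z)"
  have "norm (pairing (dual X) x (adj2 y \<psi>)) \<le> nrm (dual (dual X)) x * nrm (dual X) (adj2 y \<psi>)"
    using assms \<psi> by (intro X.dual.norm_pairing_le) auto
  also have "\<dots> \<le> nrm (dual (dual X)) x * (nrm (dual (dual Y)) y * nrm (dual Z) \<psi> * K)"
    using assms \<psi> nrm_adj2_le by (intro mult_left_mono) auto
  finally show "norm (pairing (dual X) x (adj2 y \<psi>)) \<le>
      (K * nrm (dual (dual X)) x * nrm (dual (dual Y)) y) * nrm (dual Z) \<psi>"
    by (simp add: mult_ac)
qed

lemma adj3_closed [simp]: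
  "\<lbrakk>x \<in> carrier (dual (dual X)); y \<in> carrier (dual (dual Y))\<rbrakk> \<Longrightarrow> adj3 x y \<in> carrier (dual (dual Z))"
  unfolding adj3_def by (rule Z.dual.functional_closed [OF adj3_aux])

lemma pairing_adj3 [simp]:
  "\<lbrakk>x \<in> carrier (dual (dual X)); y \<in> carrier (dual (dual Y)); \<psi> \<in> carrier (dual Z)\<rbrakk> \<Longrightarrow>
    pairing (dual Z) (adj3 x y) \<psi> = pairing (dual X) x (adj2 y \<psi>)"
  unfolding adj3_def by (rule Z.dual.pairing_functional [OF adj3_aux])

text \<open>Equality in the bidual is tested on each \<open>\<psi>\<close>, where the additivity and
  homogeneity of \<open>adj2\<close> and of the pairings apply. The constant \<open>K\<close> of
  \<open>m\<close> serves again.\<close>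

lemma bounded_bilinear_map_adj3:
  "bounded_bilinear_map (dual (dual X)) (dual (dual Y)) (dual (dual Z)) adj3"
proof -
  have "nrm (dual (dual Z)) (adj3 x y) \<le> K * nrm (dual (dual X)) x * nrm (dual (dual Y)) y"
    if "x \<in> carrier (dual (dual X))" "y \<in> carrier (dual (dual Y))" for x y
    using that adj3_aux(2) K_nonneg by (intro Z.dual.nrm_dual_le) auto
  then show ?thesis
    unfolding bounded_bilinear_map_def linear_map_def
    by (auto intro!: Z.dual.dual_eqI exI [of _ K])
qed

section \<open>The inner and the outer limit\<close>

lemma limitin_inner:
  assumes "net_to Y y G" "u \<in> carrier X"
  shows "limitin (weak_star (dual Z)) (\<lambda>v. canonical Z (m u v)) l G \<longleftrightarrow>
    l \<in> carrier (dual (dual Z)) \<and>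
    (\<forall>\<psi>\<in>carrier (dual Z). pairing (dual Z) l \<psi> = pairing (dual Y) y (adj1 \<psi> u))"
proof -
  have G: "G \<noteq> bot" "\<forall>\<^sub>F v in G. v \<in> carrier Y"
    and lim: "\<And>\<phi>. \<phi> \<in> carrier (dual Y) \<Longrightarrow> ((\<lambda>v. pairing Y \<phi> v) \<longlongrightarrow> pairing (dual Y) y \<phi>) G"
    using assms(1) by (auto simp: Y.net_to_iff)
  have ev: "\<forall>\<^sub>F v in G. canonical Z (m u v) \<in> carrier (dual (dual Z))"
    using G(2) assms(2) by (auto elim!: eventually_mono intro: Z.canonical_closed)
  \<comment> \<open>The pairing is \<open>adj1 \<psi> u\<close> evaluated at \<open>v\<close>, so
    convergence of \<open>G\<close> to \<open>y\<close> gives its limit; properness of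
    \<open>G\<close> then makes the limit unique.\<close>
  have "((\<lambda>v. pairing (dual Z) (canonical Z (m u v)) \<psi>) \<longlongrightarrow> pairing (dual Y) y (adj1 \<psi> u)) G"
    if "\<psi> \<in> carrier (dual Z)" for \<psi>
    using lim [of "adj1 \<psi> u"] that assms(2)
    by (rule_tac Lim_transform_eventually [where f = "pairing Y (adj1 \<psi> u)"])
      (auto intro: eventually_mono [OF G(2)])
  then have "((\<lambda>v. pairing (dual Z) (canonical Z (m u v)) \<psi>) \<longlongrightarrow> c) G \<longleftrightarrow>
      c = pairing (dual Y) y (adj1 \<psi> u)" if "\<psi> \<in> carrier (dual Z)" for \<psi> c
    using that tendsto_unique [OF G(1)] by blast
  then show ?thesis
    using Z.dual.limitin_weak_star [OF ev] by auto
qed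

lemma limitin_outer:
  assumes "net_to X x F" "y \<in> carrier (dual (dual Y))"
    and l: "\<And>u. u \<in> carrier X \<Longrightarrow> l u \<in> carrier (dual (dual Z)) \<and>
      (\<forall>\<psi>\<in>carrier (dual Z). pairing (dual Z) (l u) \<psi> = pairing (dual Y) y (adj1 \<psi> u))"
  shows "limitin (weak_star (dual Z)) l z F \<longleftrightarrow> z = adj3 x y"
proof -
  have F: "F \<noteq> bot" "\<forall>\<^sub>F u in F. u \<in> carrier X" and x: "x \<in> carrier (dual (dual X))"
    and lim: "\<And>\<phi>. \<phi> \<in> carrier (dual X) \<Longrightarrow> ((\<lambda>u. pairing X \<phi> u) \<longlongrightarrow> pairing (dual X) x \<phi>) F"
    using assms(1) by (auto simp: X.net_to_iff)
  have ev: "\<forall>\<^sub>F u in F. l u \<in> carrier (dual (dual Z))"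
    using F(2) l by (auto elim!: eventually_mono)
  \<comment> \<open>For \<open>u\<close> in the carrier, where \<open>F\<close> eventually lives,
    this pairing is \<open>adj2 y \<psi>\<close> evaluated at \<open>u\<close>.\<close>
  have "((\<lambda>u. pairing (dual Z) (l u) \<psi>) \<longlongrightarrow> pairing (dual X) x (adj2 y \<psi>)) F"
    if "\<psi> \<in> carrier (dual Z)" for \<psi>
    using lim [of "adj2 y \<psi>"] that assms(2) l
    by (rule_tac Lim_transform_eventually [where f = "pairing X (adj2 y \<psi>)"])
      (auto intro: eventually_mono [OF F(2)])
  then have "((\<lambda>u. pairing (dual Z) (l u) \<psi>) \<longlongrightarrow> c) F \<longleftrightarrow> c = pairing (dual Z) (adj3 x y) \<psi>"
    if "\<psi> \<in> carrier (dual Z)" for \<psi> c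
    using that tendsto_unique [OF F(1)] x assms(2) by auto
  then show ?thesis
    using Z.dual.limitin_weak_star [OF ev] x assms(2) by (auto intro: Z.dual.dual_eqI)
qed

text \<open>The value \<open>adj3 x y\<close> meets the specification for all nets, and a single
  pair of nets already forces it, so the definite description denotes it.\<close>

lemma arens_eq_adj3:
  assumes "x \<in> carrier (dual (dual X))" "y \<in> carrier (dual (dual Y))"
  shows "arens X Y Z m x y = adj3 x y"
  unfolding arens_def
proof (rule the_equality)
  \<comment> \<open>The inner limit as a point of the bidual: the bound known for
    \<open>adj2\<close>, regrouped as a bound in \<open>\<psi>\<close>.\<close>
  have inner: "functional (dual Z) (\<lambda>\<psi>. pairing (dual Y) y (adj1 \<psi> u)) \<in> carrier (dual (dual Z)) \<and>
    (\<forall>\<psi>\<in>carrier (dual Z). pairing (dual Z) (functional (dual Z) (\<lambda>\<psi>. pairing (dual Y) y (adj1 \<psi> u))) \<psi> =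
      pairing (dual Y) y (adj1 \<psi> u))" if u: "u \<in> carrier X" for u
  proof -
    have "linear_form (dual Z) (\<lambda>\<psi>. pairing (dual Y) y (adj1 \<psi> u))"
      using assms u by (auto simp: linear_form_def)
    moreover have "norm (pairing (dual Y) y (adj1 \<psi> u)) \<le>
        (nrm (dual (dual Y)) y * K * nrm X u) * nrm (dual Z) \<psi>" if "\<psi> \<in> carrier (dual Z)" for \<psi>
      using adj2_aux(2) [OF assms(2) that u] by (simp add: mult_ac)
    ultimately show ?thesis
      using Z.dual.functional_closed Z.dual.pairing_functional by blast
  qed
  show "adj3 x y \<in> carrier (dual (dual Z)) \<and>
    (\<forall>F G. net_to X x F \<and> net_to Y y G \<longrightarrow>
      (\<exists>l. (\<forall>u\<in>carrier X. limitin (weak_star (dual Z)) (\<lambda>v. canonical Z (m u v)) (l u) G) \<and>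
           limitin (weak_star (dual Z)) l (adj3 x y) F))"
  proof (intro conjI allI impI)
    fix F G assume "net_to X x F \<and> net_to Y y G"
    then show "\<exists>l. (\<forall>u\<in>carrier X. limitin (weak_star (dual Z)) (\<lambda>v. canonical Z (m u v)) (l u) G) \<and>
           limitin (weak_star (dual Z)) l (adj3 x y) F"
      using inner limitin_outer [OF _ assms(2) inner]
      by (intro exI [of _ "\<lambda>u. functional (dual Z) (\<lambda>\<psi>. pairing (dual Y) y (adj1 \<psi> u))"])
        (auto simp: limitin_inner)
  qed (use assms in auto)
next
  fix z
  assume z: "z \<in> carrier (dual (dual Z)) \<and>
    (\<forall>F G. net_to X x F \<and> net_to Y y G \<longrightarrow>
      (\<exists>l. (\<forall>u\<in>carrier X. limitin (weak_star (dual Z)) (\<lambda>v. canonical Z (m u v)) (l u) G) \<and>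
           limitin (weak_star (dual Z)) l z F))"
  \<comment> \<open>If no nets converged to \<open>x\<close> and \<open>y\<close>, every
    \<open>z\<close> would satisfy the specification vacuously; weak* density supplies them.\<close>
  obtain F G where FG: "net_to X x F" "net_to Y y G"
    using X.net_to_exists Y.net_to_exists assms by blast
  with z obtain l where
    "\<forall>u\<in>carrier X. limitin (weak_star (dual Z)) (\<lambda>v. canonical Z (m u v)) (l u) G"
    and z: "limitin (weak_star (dual Z)) l z F" by blast
  then show "z = adj3 x y"
    using limitin_outer [OF FG(1) assms(2), of l z] limitin_inner [OF FG(2)] by blast
qed

text \<open>Bounded bilinearity looks only at arguments in the carriers, and there
  \<open>arens\<close> coincides with \<open>adj3\<close>.\<close>

lemma bounded_bilinear_map_arens:
  "bounded_bilinear_map (dual (dual X)) (dual (dual Y)) (dual (dual Z)) (arens X Y Z m)"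
proof -
  have "bounded_bilinear_map (dual (dual X)) (dual (dual Y)) (dual (dual Z)) (arens X Y Z m) \<longleftrightarrow>
    bounded_bilinear_map (dual (dual X)) (dual (dual Y)) (dual (dual Z)) adj3"
    unfolding bounded_bilinear_map_def linear_map_def
    by (simp add: arens_eq_adj3 Pi_iff cong: ball_cong)
  then show ?thesis
    using bounded_bilinear_map_adj3 by blast
qed

end


section \<open>Topological centers\<close>

lemma pre_normed_ndual:
  assumes "pre_normed X" "\<And>i. i < n \<Longrightarrow> functionals (ndual i X) \<lesssim> (UNIV :: 'u set)"
  shows "pre_normed (ndual n (X :: ('k::real_normed_field, 'u) nspace))"
  using assms(2)
proof (induction n)
  case (Suc n)
  then interpret dualizable "ndual n X"
    by (intro dualizable.intro dualizable_axioms.intro) auto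
  show ?case by (simp add: pre_normed_dual)
qed (simp add: assms(1))

text \<open>Dualizability at order \<open>i\<close> asks for room for the dual of order
  \<open>i + 1\<close>; room up to order \<open>n + 1\<close> therefore reaches
  \<open>i = n\<close>.\<close>

lemma dualizable_ndual:
  assumes "pre_normed X" "admits_duals (n + 1) X" "i \<le> n"
  shows "dualizable (ndual i X)"
  using assms unfolding admits_duals_def
  by (intro dualizable.intro dualizable_axioms.intro pre_normed_ndual) auto

lemma bidualizable_ndual:
  assumes "pre_normed X" "admits_duals (n + 1) X" "i < n"
  shows "bidualizable (ndual i X)"
  using dualizable_ndual [OF assms(1,2), of i] dualizable_ndual [OF assms(1,2), of "Suc i"] assms(3)
  by (simp add: bidualizable_def)

text \<open>Three separate spaces let one induction cover the left action, the right action and the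
  product.\<close>

lemma bounded_bilinear_map_arens_iter:
  assumes X: "pre_normed X" "admits_duals (n + 1) X"
    and Y: "pre_normed Y" "admits_duals (n + 1) Y"
    and Z: "pre_normed Z" "admits_duals (n + 1) Z"
    and m: "bounded_bilinear_map X Y Z m"
    and "2 * j \<le> n"
  shows "bounded_bilinear_map (ndual (2 * j) X) (ndual (2 * j) Y) (ndual (2 * j) Z) (arens_iter X Y Z m j)"
  using assms(8)
proof (induction j)
  case (Suc j)
  \<comment> \<open>From \<open>2 * Suc j \<le> n\<close> follows \<open>2 * j < n\<close>, the
    range in which the spaces are bidualizable.\<close>
  interpret arens_extension "ndual (2 * j) X" "ndual (2 * j) Y" "ndual (2 * j) Z" "arens_iter X Y Z m j"
    using Suc bidualizable_ndual [OF X] bidualizable_ndual [OF Y] bidualizable_ndual [OF Z]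
    by (intro arens_extension.intro arens_extension_axioms.intro) auto
  show ?case
    using bounded_bilinear_map_arens by simp
qed (simp add: m)

text \<open>The first two facts fix the algebra element of a left action, the last two that of a
  right action, where it is the second argument.\<close>

lemma bounded_bilinear_mapD:
  assumes "bounded_bilinear_map X Y Z m" "pre_normed X" "pre_normed Y"
  shows "x \<in> carrier X \<Longrightarrow> linear_map Y Z (m x)"
    and "x \<in> carrier X \<Longrightarrow> \<exists>K\<ge>0. \<forall>y\<in>carrier Y. nrm Z (m x y) \<le> K * nrm Y y"
    and "y \<in> carrier Y \<Longrightarrow> linear_map X Z (\<lambda>x. m x y)"
    and "y \<in> carrier Y \<Longrightarrow> \<exists>K\<ge>0. \<forall>x\<in>carrier X. nrm Z (m x y) \<le> K * nrm X x"
proof -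
  interpret X: pre_normed X by fact
  interpret Y: pre_normed Y by fact
  obtain K where "K \<ge> 0"
    and K: "\<forall>x\<in>carrier X. \<forall>y\<in>carrier Y. nrm Z (m x y) \<le> K * nrm X x * nrm Y y"
    using bounded_bilinear_map_nonneg_bound [OF assms] by blast
  show "x \<in> carrier X \<Longrightarrow> linear_map Y Z (m x)"
    and "y \<in> carrier Y \<Longrightarrow> linear_map X Z (\<lambda>x. m x y)"
    using assms(1) unfolding bounded_bilinear_map_def by blast+
  show "x \<in> carrier X \<Longrightarrow> \<exists>K\<ge>0. \<forall>y\<in>carrier Y. nrm Z (m x y) \<le> K * nrm Y y"
    using K \<open>K \<ge> 0\<close> by (intro exI [of _ "K * nrm X x"]) auto
  show "y \<in> carrier Y \<Longrightarrow> \<exists>K\<ge>0. \<forall>x\<in>carrier X. nrm Z (m x y) \<le> K * nrm X x"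
    using K \<open>K \<ge> 0\<close> by (intro exI [of _ "K * nrm Y y"]) (auto simp: mult_ac)
qed

section \<open>Transposing the actions of the even duals\<close>

context
  fixes A :: "('k::real_normed_field, 'u) nspace" and B :: "('k, 'v) nspace" and n :: nat
  assumes A: "pre_normed A" "admits_duals (n + 1) A"
    and B: "pre_normed B" "admits_duals (n + 1) B"
    and n: "even n" "n \<ge> 2"
begin

lemma topspace_weak_star_ndual: "topspace (weak_star (ndual (n - 1) A)) = carrier (ndual n A)"
proof -
  interpret dualizable "ndual (n - 1) A"
    using dualizable_ndual [OF A] by simp
  \<comment> \<open>Since \<open>weak_star\<close> takes the predual as its argument,
    \<open>n - 1\<close> must be a true predecessor, which \<open>n \<ge> 2\<close>
    guarantees.\<close>
  have "ndual n A = dual (ndual (n - 1) A)"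
    using n by (cases n) auto
  then show ?thesis
    using topspace_weak_star by simp
qed

text \<open>Transposing the left action on \<open>ndual n B\<close> gives \<open>dual_ract\<close>.
  Each center is a subset of its carrier, so equality says that the continuity condition holds at
  every point.\<close>

lemma Z_left_eq_iff:
  assumes "bounded_bilinear_map A B B lact"
  shows "Z_left n A B lact = carrier (ndual (n + 1) B) \<longleftrightarrow> Zt_right n A B lact = carrier (ndual n B)"
proof -
  interpret A: dualizable "ndual n A" using dualizable_ndual [OF A] by simp
  interpret B: dualizable "ndual n B" using dualizable_ndual [OF B] by simp
  \<comment> \<open>Evenness turns the order \<open>2 * (n div 2)\<close> of the iterated extension
    into \<open>n\<close>.\<close>
  have "bounded_bilinear_map (ndual n A) (ndual n B) (ndual n B) (nlact n A B lact)"
    using bounded_bilinear_map_arens_iter [OF A B B assms, of "n div 2"] n by (simp add: nlact_def)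
  note bilinear = bounded_bilinear_mapD [OF this A.pre_normed_axioms B.pre_normed_axioms]
  show ?thesis
    using B.continuous_weak_star_transpose_iff
        [of "weak_star (ndual (n - 1) A)" "\<lambda>a b. nlact n A B lact a b"] bilinear(1,2)
    unfolding Z_left_def Zt_right_def dual_ract_def topspace_weak_star_ndual by auto
qed

text \<open>The same transposition with the arguments of the action exchanged, since the algebra
  element now stands on the right.\<close>

lemma Z_right_eq_iff:
  assumes "bounded_bilinear_map B A B ract"
  shows "Z_right n A B ract = carrier (ndual (n + 1) B) \<longleftrightarrow> Zt_left n A B ract = carrier (ndual n B)"
proof -
  interpret A: dualizable "ndual n A" using dualizable_ndual [OF A] by simp
  interpret B: dualizable "ndual n B" using dualizable_ndual [OF B] by simp
  have "bounded_bilinear_map (ndual n B) (ndual n A) (ndual n B) (nract n A B ract)"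
    using bounded_bilinear_map_arens_iter [OF B A B assms, of "n div 2"] n by (simp add: nract_def)
  note bilinear = bounded_bilinear_mapD [OF this B.pre_normed_axioms A.pre_normed_axioms]
  show ?thesis
    using B.continuous_weak_star_transpose_iff
        [of "weak_star (ndual (n - 1) A)" "\<lambda>a b. nract n A B ract b a"] bilinear(3,4)
    unfolding Z_right_def Zt_left_def dual_lact_def topspace_weak_star_ndual by auto
qed

end

theorem theorem2p7:
  fixes A :: "('k::real_normed_field, 'u) nspace" and B :: "('k, 'v) nspace"
    and lact :: "'u \<Rightarrow> 'v \<Rightarrow> 'v" and ract :: "'v \<Rightarrow> 'u \<Rightarrow> 'v" and n :: nat
  assumes "banach_algebra A"
    and "banach_bimodule A B lact ract"
    and "even n" and "n \<ge> 2"
    and "admits_duals (n + 1) A" and "admits_duals (n + 1) B"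
  shows "(Z_left n A B lact = carrier (ndual (n + 1) B) \<longleftrightarrow>
      Zt_right n A B lact = carrier (ndual n B)) \<and>
     (Z_left n A A (mult A) = carrier (ndual (n + 1) A) \<longleftrightarrow>
      Zt_right n A A (mult A) = carrier (ndual n A)) \<and>
     (Z_right n A A (mult A) = carrier (ndual (n + 1) A) \<longleftrightarrow>
      Zt_left n A A (mult A) = carrier (ndual n A)) \<and>
     (Z_right n A B ract = carrier (ndual (n + 1) B) \<longleftrightarrow>
      Zt_left n A B ract = carrier (ndual n B))"
proof -
  interpret A: banach_algebra A by fact
  interpret B: banach_bimodule A B lact ract by fact
  \<comment> \<open>The second and third equivalences are the case \<open>B = A\<close>, with
    \<open>mult A\<close> in the place of the left and of the right action.\<close>
  show ?thesis
    by (intro conjI Z_left_eq_iff Z_right_eq_iff assms A.pre_normed B.B.pre_normed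
        B.lact_bilinear B.ract_bilinear A.mult_bilinear)
qed

end
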